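(* Let $n\ge 1$ and $x,y\in[0,\infty)^n$. If $x\prec_F y$, then $x\prec_L y$. (Here $\prec_F$ and $\prec_L$ are the relations defined in the context.)
   Context: For integers $k,r\ge 1$, define the polynomial $F_{k,r}$ in $n$ variables by $$F_{k,r}(x_1,\dots,x_n)=\sum_{k_1+\dots+k_n=k,\ \max_i k_i\le r}\ \prod_{i=1}^n\frac{x_i^{k_i}}{k_i!},$$ where the $k_i$ range over nonnegative integers (so $F_{k,r}(x)$ is the coefficient of $t^k$ in $\prod_{i=1}^n\left(1+x_it+\dots+\frac{(x_it)^r}{r!}\right)$, and $F_{k,r}=0$ for $k>nr$). Relation $\prec_F$ on $[0,\infty)^n$: $x\prec_F y$ iff $F_{k,r}(x)\le F_{k,r}(y)$ for all integers $k,r\ge1$. Relation $\prec_L$ on $[0,\infty)^n$: $x\prec_L y$ iff $\sum_{i=1}^n\psi(x_i)\le\sum_{i=1}^n\psi(y_i)$ for every (finite-valued) function $\psi:[0,\infty)\to[0,\infty)$ of the form $\psi(s)=\int_0^s\varphi(t)\frac{dt}{t}$ for some nondecreasing concave $\varphi:[0,\infty)\to[0,\infty)$. *)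

theory Defs
  imports "HOL-Analysis.Analysis"
begin

definition F :: "nat \<Rightarrow> nat \<Rightarrow> real ^ 'n \<Rightarrow> real" where
  "F k r x = (\<Sum>\<kappa> \<in> {\<kappa> :: 'n \<Rightarrow> nat. (\<Sum>i\<in>UNIV. \<kappa> i) = k \<and> (\<forall>i. \<kappa> i \<le> r)}.
                \<Prod>i\<in>UNIV. (x $ i) ^ \<kappa> i / fact (\<kappa> i))"

lemma finite_F_index:
  "finite {\<kappa> :: 'n::finite \<Rightarrow> nat. (\<Sum>i\<in>UNIV. \<kappa> i) = k \<and> (\<forall>i. \<kappa> i \<le> r)}"
proof (rule finite_subset)
  show "{\<kappa> :: 'n \<Rightarrow> nat. (\<Sum>i\<in>UNIV. \<kappa> i) = k \<and> (\<forall>i. \<kappa> i \<le> r)} \<subseteq> (\<Pi>\<^sub>E i\<in>UNIV. {..r})"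
    by auto
  show "finite (\<Pi>\<^sub>E i\<in>(UNIV :: 'n set). {..r})"
    by (intro finite_PiE) auto
qed

definition prec_F :: "real ^ 'n \<Rightarrow> real ^ 'n \<Rightarrow> bool" (infix "\<prec>\<^sub>F" 50) where
  "x \<prec>\<^sub>F y \<longleftrightarrow> (\<forall>k r. k \<ge> 1 \<longrightarrow> r \<ge> 1 \<longrightarrow> F k r x \<le> F k r y)"

(* Only the values on [0,\<infinity>) of the functions below matter.  Since the integrand is
   nonnegative, the gauge integral is the Lebesgue integral, and its existence for every s
   expresses that \<psi> is finite-valued. *)
definition L_functions :: "(real \<Rightarrow> real) set" where
  "L_functions = {\<psi>. \<psi> \<in> {0..} \<rightarrow> {0..} \<and>
     (\<exists>\<phi>. \<phi> \<in> {0..} \<rightarrow> {0..} \<and> mono_on {0..} \<phi> \<and> concave_on {0..} \<phi> \<and>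
        (\<forall>s\<ge>0. ((\<lambda>t. \<phi> t / t) has_integral \<psi> s) {0<..s}))}"

definition prec_L :: "real ^ 'n \<Rightarrow> real ^ 'n \<Rightarrow> bool" (infix "\<prec>\<^sub>L" 50) where
  "x \<prec>\<^sub>L y \<longleftrightarrow> (\<forall>\<psi>\<in>L_functions. (\<Sum>i\<in>UNIV. \<psi> (x $ i)) \<le> (\<Sum>i\<in>UNIV. \<psi> (y $ i)))"

end

theory Submission
  imports Defs
begin

text \<open>
  On a bounded interval \<open>[0, M]\<close>, every nondecreasing concave \<open>\<phi>\<close> that vanishes and is
  continuous at the origin is a mixture of the functions \<open>t \<mapsto> min t a\<close>, so the functions \<open>\<psi>\<close> defining \<open>\<prec>\<^sub>L\<close> are mixtures of
  \<open>s \<mapsto> a * \<Lambda>(s / a)\<close>, where \<open>\<Lambda>(s) = s\<close> for \<open>s \<le> 1\<close> and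
  \<open>\<Lambda>(s) = 1 + ln s\<close> for \<open>s > 1\<close>.  These extremal functions are visible in the
  polynomials \<open>F\<close>.  Indeed, let \<open>p\<^sub>r(s) = (\<Sum>j\<le>r. s^j / j!)\<close>.  Summing \<open>F k r\<close> over
  all \<open>k\<close> gives the product of the \<open>p\<^sub>r(x\<^sub>i)\<close> (\<open>prod_exp_trunc_eq_sum_F\<close>), and
  \<open>F k r\<close> is homogeneous, so \<open>x \<prec>\<^sub>F y\<close> yields
  \<open>(\<Prod>i. p\<^sub>r(c x\<^sub>i)) \<le> (\<Prod>i. p\<^sub>r(c y\<^sub>i))\<close> for all \<open>c \<ge> 0\<close>.
  On the scale \<open>s \<mapsto> r s\<close> the truncated exponential satisfies
  \<open>ln (p\<^sub>r(r s)) = r \<Lambda>(s) + O(1 + ln r)\<close>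
  (\<open>exp_trunc_upper\<close>, \<open>ln_exp_trunc_lower\<close>): below \<open>1\<close> it behaves like the full exponential,
  above \<open>1\<close> its last term dominates.  Taking logarithms, dividing by \<open>r\<close> and letting
  \<open>r\<close> tend to infinity gives the inequality for \<open>\<Lambda>\<close> at every scale
  (\<open>prec_F_sum_log_env_le\<close>).

  To pass from the extremal functions to a general \<open>\<phi>\<close> without a representing measure,
  \<open>\<phi>\<close> is interpolated linearly on the grid of multiples of \<open>h\<close>.  The interpolant is a
  combination of differences of functions \<open>min t a\<close> whose coefficients, the slopes
  of \<open>\<phi>\<close>, are nonnegative and nonincreasing, so summation by parts gives the
  inequality for it (\<open>prec_F_interpolant_potential_le\<close>).  As \<open>h\<close> tends to zero the
  interpolants converge to \<open>\<phi>\<close> from below, and dominated convergence carries the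
  inequality over to \<open>\<psi>\<close> (\<open>interpolant_potential_tendsto\<close>).
\<close>

section \<open>Truncated exponentials\<close>

definition exp_trunc :: "nat \<Rightarrow> real \<Rightarrow> real" where
  "exp_trunc r s = (\<Sum>j\<le>r. s ^ j / fact j)"

text \<open>
  The limit of \<open>ln (exp_trunc r (r * s)) / r\<close> for large \<open>r\<close>; it is continuously
  differentiable on the positive axis, with derivative \<open>min s 1 / s\<close>.
\<close>
definition log_env :: "real \<Rightarrow> real" where
  "log_env s = (if s \<le> 1 then s else 1 + ln s)"

lemma exp_trunc_le_exp:
  assumes "0 \<le> s"
  shows "exp_trunc r s \<le> exp s"
proof -
  have "exp_trunc r s = (\<Sum>j\<le>r. inverse (fact j) * s ^ j)"
    by (simp add: exp_trunc_def field_simps)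
  also have "\<dots> \<le> (\<Sum>j. inverse (fact j) * s ^ j)"
    by (rule sum_le_suminf[OF summable_exp]) (use assms in auto)
  also have "\<dots> = exp s"
    by (simp add: exp_def)
  finally show ?thesis .
qed

lemma exp_trunc_ge_term:
  assumes "0 \<le> s" "j \<le> r"
  shows "s ^ j / fact j \<le> exp_trunc r s"
  unfolding exp_trunc_def by (rule member_le_sum) (use assms in auto)

lemma exp_trunc_pos:
  assumes "0 \<le> s"
  shows "0 < exp_trunc r s"
  using exp_trunc_ge_term[OF assms, of 0 r] by simp

text \<open>
  For \<open>s > 1\<close> each \<open>s ^ j\<close> is at most \<open>s ^ r\<close>, and what remains is the
  exponential series truncated at argument \<open>r\<close>.
\<close>
lemma exp_trunc_upper:
  assumes "0 \<le> s"
  shows "exp_trunc r (real r * s) \<le> exp (real r * log_env s)"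
proof (cases "s \<le> 1")
  case True
  then show ?thesis
    using exp_trunc_le_exp[of "real r * s" r] assms by (simp add: log_env_def)
next
  case False
  have "exp_trunc r (real r * s) = (\<Sum>j\<le>r. s ^ j * (real r ^ j / fact j))"
    by (simp add: exp_trunc_def power_mult_distrib mult.commute)
  also have "\<dots> \<le> (\<Sum>j\<le>r. s ^ r * (real r ^ j / fact j))"
    by (intro sum_mono mult_right_mono power_increasing) (use False in auto)
  also have "\<dots> = s ^ r * exp_trunc r (real r)"
    by (simp add: exp_trunc_def sum_distrib_left)
  also have "\<dots> \<le> s ^ r * exp (real r)"
    by (intro mult_left_mono exp_trunc_le_exp) (use False in auto)
  also have "s ^ r = exp (real r * ln s)"
    using False by (simp add: exp_of_nat_mult)
  finally show ?thesis
    using False by (simp add: log_env_def distrib_left exp_add mult.commute)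
qed

text \<open>
  Stirling's upper bound \<open>n! \<le> e n (n / e)^n\<close>.  The induction step amounts to
  \<open>(n / (n + 1))^(n + 1) \<le> 1 / e\<close>.
\<close>
lemma fact_le_Stirling:
  assumes "1 \<le> n"
  shows "exp (real n) * fact n \<le> exp 1 * (real n * real n ^ n)"
  using assms
proof (induction n rule: dec_induct)
  case base
  then show ?case by simp
next
  case (step n)
  have n: "0 < real n" using step.hyps by simp
  have "real n / (real n + 1) = 1 + (- 1 / (real n + 1))"
    using n by (simp add: field_simps)
  also have "\<dots> \<le> exp (- 1 / (real n + 1))"
    by (rule exp_ge_add_one_self)
  finally have "(real n / (real n + 1)) ^ Suc n \<le> exp (- 1 / (real n + 1)) ^ Suc n"
    by (rule power_mono) (use n in auto)
  also have "\<dots> = exp (real (Suc n) * (- 1 / (real n + 1)))"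
    by (rule exp_of_nat_mult[symmetric])
  also have "real (Suc n) * (- 1 / (real n + 1)) = - 1"
    using n by (simp add: field_simps)
  finally have "real n ^ Suc n / (real n + 1) ^ Suc n \<le> exp (- 1)"
    by (simp only: power_divide)
  then have key: "exp 1 * real n ^ Suc n \<le> (real n + 1) ^ Suc n"
    using n by (simp add: pos_divide_le_eq exp_minus pos_le_divide_eq mult.commute inverse_eq_divide del: power_Suc)
  have "exp (real (Suc n)) * fact (Suc n)
      = exp 1 * (real n + 1) * (exp (real n) * fact n)"
    by (simp add: exp_add algebra_simps)
  also have "\<dots> \<le> exp 1 * (real n + 1) * (exp 1 * (real n * real n ^ n))"
    by (rule mult_left_mono[OF step.IH]) (use n in auto)
  also have "\<dots> = exp 1 * (real n + 1) * (exp 1 * real n ^ Suc n)"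
    by simp
  also have "\<dots> \<le> exp 1 * (real n + 1) * (real n + 1) ^ Suc n"
    by (rule mult_left_mono[OF key]) (use n in auto)
  finally show ?case
    by (simp add: algebra_simps)
qed

lemma ln_power_div_fact_ge:
  assumes "1 \<le> n"
  shows "real n - 1 - ln (real n) \<le> ln (real n ^ n / fact n)"
proof -
  have n: "0 < real n" using assms by simp
  have "exp (real n - 1 - ln (real n)) = exp (real n) / (exp 1 * real n)"
    using n by (simp add: exp_diff)
  also have "\<dots> \<le> real n ^ n / fact n"
    using fact_le_Stirling[OF assms] n by (simp add: divide_simps mult_ac)
  finally show ?thesis
    using n by (simp add: ln_ge_iff)
qed

text \<open>
  A single term of the sum is enough: the one of index \<open>\<lfloor>r s\<rfloor>\<close>, which is the largest of the
  exponential series at \<open>r s\<close>, if \<open>s \<le> 1\<close>, and the last one otherwise.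
  Stirling's bound loses \<open>1 + ln r\<close>, and rounding \<open>r s\<close> down loses at most \<open>1\<close> more.
\<close>
lemma ln_exp_trunc_lower:
  assumes "0 \<le> s" "1 \<le> r"
  shows "real r * log_env s - 2 - ln (real r) \<le> ln (exp_trunc r (real r * s))"
proof -
  have rs: "0 \<le> real r * s" using assms by simp
  have lnr: "0 \<le> ln (real r)" using assms by simp
  show ?thesis
  proof (cases "s \<le> 1")
    case True
    define j where "j = nat \<lfloor>real r * s\<rfloor>"
    have j: "real j \<le> real r * s" "real r * s < real j + 1"
      unfolding j_def using rs by linarith+
    have "real r * s \<le> real r" using True by (simp add: mult_left_le)
    then have jr: "j \<le> r" using j by linarith
    show ?thesis
      \<comment> \<open>For \<open>j = 0\<close> Stirling's bound is void, but then \<open>r * s < 1\<close>.\<close>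
    proof (cases "j = 0")
      case True
      have "1 \<le> exp_trunc r (real r * s)"
        using exp_trunc_ge_term[OF rs, of 0 r] by simp
      then have "0 \<le> ln (exp_trunc r (real r * s))" by simp
      then show ?thesis
        using True j lnr \<open>s \<le> 1\<close> by (simp add: log_env_def)
    next
      case False
      then have j1: "1 \<le> j" by simp
      have "real j - 1 - ln (real j) \<le> ln (real j ^ j / fact j)"
        by (rule ln_power_div_fact_ge[OF j1])
      also have "\<dots> \<le> ln (exp_trunc r (real r * s))"
      proof (rule ln_mono)
        have "real j ^ j / fact j \<le> (real r * s) ^ j / fact j"
          by (intro divide_right_mono power_mono) (use j in auto)
        also have "\<dots> \<le> exp_trunc r (real r * s)"
          by (rule exp_trunc_ge_term[OF rs jr])
        finally show "real j ^ j / fact j \<le> exp_trunc r (real r * s)" .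
      qed (use j1 in simp_all)
      finally have "real j - 1 - ln (real j) \<le> ln (exp_trunc r (real r * s))" .
      moreover have "ln (real j) \<le> ln (real r)"
        using j1 jr by simp
      ultimately show ?thesis
        using j True by (simp add: log_env_def)
    qed
  next
    case False
    have "real r * log_env s - 2 - ln (real r)
        \<le> real r * ln s + (real r - 1 - ln (real r))"
      using False by (simp add: log_env_def algebra_simps)
    also have "\<dots> \<le> real r * ln s + ln (real r ^ r / fact r)"
      using ln_power_div_fact_ge[OF assms(2)] by simp
    also have "\<dots> = ln (s ^ r * (real r ^ r / fact r))"
      using False assms by (subst ln_mult) (auto simp: ln_realpow)
    also have "\<dots> = ln ((real r * s) ^ r / fact r)"
      by (simp add: power_mult_distrib mult.commute)
    also have "\<dots> \<le> ln (exp_trunc r (real r * s))"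
      by (rule ln_mono[OF exp_trunc_ge_term[OF rs order_refl]]) (use False assms in auto)
    finally show ?thesis .
  qed
qed

section \<open>From the polynomials to the logarithmic envelope\<close>

text \<open>
  Expanding the product picks one exponent \<open>\<kappa> i \<le> r\<close> per factor; \<open>F k r x\<close> collects
  the monomials of total degree \<open>k\<close>, and no degree exceeds \<open>CARD('n) * r\<close>.
\<close>
lemma prod_exp_trunc_eq_sum_F:
  fixes x :: "real ^ 'n"
  shows "(\<Prod>i\<in>UNIV. exp_trunc r (x $ i)) = (\<Sum>k\<le>CARD('n) * r. F k r x)"
proof -
  let ?A = "Pi\<^sub>E (UNIV :: 'n set) (\<lambda>_. {..r})"
  let ?g = "\<lambda>\<kappa>. \<Prod>i\<in>UNIV. (x $ i) ^ \<kappa> i / fact (\<kappa> i)"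
  have "(\<Prod>i\<in>UNIV. exp_trunc r (x $ i)) = sum ?g ?A"
    unfolding exp_trunc_def by (rule prod_sum_PiE) auto
  also have "\<dots> = (\<Sum>k\<le>CARD('n) * r. sum ?g {\<kappa>. \<kappa> \<in> ?A \<and> (\<Sum>i\<in>UNIV. \<kappa> i) = k})"
  proof (rule sum.group[symmetric])
    show "finite ?A" by (intro finite_PiE) auto
    show "(\<lambda>\<kappa>. \<Sum>i\<in>UNIV. \<kappa> i) ` ?A \<subseteq> {..CARD('n) * r}"
    proof (rule image_subsetI)
      fix \<kappa> assume "\<kappa> \<in> ?A"
      then show "(\<Sum>i\<in>UNIV. \<kappa> i) \<in> {..CARD('n) * r}"
        using sum_bounded_above[of UNIV \<kappa> r] by (force simp: PiE_UNIV_domain)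
    qed
  qed simp
  also have "\<dots> = (\<Sum>k\<le>CARD('n) * r. F k r x)"
    unfolding F_def by (intro sum.cong refl) (auto simp: PiE_UNIV_domain)
  finally show ?thesis .
qed

lemma F_scale: "F k r (c *\<^sub>R x) = c ^ k * F k r x"
  unfolding F_def sum_distrib_left
proof (rule sum.cong[OF refl])
  fix \<kappa> :: "'a \<Rightarrow> nat"
  assume "\<kappa> \<in> {\<kappa>. (\<Sum>i\<in>UNIV. \<kappa> i) = k \<and> (\<forall>i. \<kappa> i \<le> r)}"
  then have "(\<Prod>i\<in>UNIV. c ^ \<kappa> i) = c ^ k"
    by (simp add: power_sum[symmetric])
  then show "(\<Prod>i\<in>UNIV. ((c *\<^sub>R x) $ i) ^ \<kappa> i / fact (\<kappa> i))
      = c ^ k * (\<Prod>i\<in>UNIV. (x $ i) ^ \<kappa> i / fact (\<kappa> i))"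
    by (simp add: power_mult_distrib prod.distrib flip: times_divide_eq_right)
qed

lemma prec_F_prod_exp_trunc_le:
  fixes x y :: "real ^ 'n"
  assumes "x \<prec>\<^sub>F y" "0 \<le> c" "1 \<le> r"
  shows "(\<Prod>i\<in>UNIV. exp_trunc r (c * x $ i)) \<le> (\<Prod>i\<in>UNIV. exp_trunc r (c * y $ i))"
proof -
  \<comment> \<open>The relation compares only degrees \<open>k \<ge> 1\<close>; the constant terms agree.\<close>
  have F0: "F 0 r z = 1" for z :: "real ^ 'n"
  proof -
    have "{\<kappa> :: 'n \<Rightarrow> nat. (\<Sum>i\<in>UNIV. \<kappa> i) = 0 \<and> (\<forall>i. \<kappa> i \<le> r)} = {\<lambda>_. 0}"
      by auto
    then show ?thesis by (simp add: F_def)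
  qed
  have "F k r (c *\<^sub>R x) \<le> F k r (c *\<^sub>R y)" for k
  proof (cases "k = 0")
    case True
    then show ?thesis by (simp add: F0)
  next
    case False
    then have "F k r x \<le> F k r y" using assms by (simp add: prec_F_def)
    then show ?thesis using assms by (simp add: F_scale mult_left_mono)
  qed
  then have "(\<Prod>i\<in>UNIV. exp_trunc r ((c *\<^sub>R x) $ i)) \<le> (\<Prod>i\<in>UNIV. exp_trunc r ((c *\<^sub>R y) $ i))"
    unfolding prod_exp_trunc_eq_sum_F by (intro sum_mono)
  then show ?thesis by simp
qed

text \<open>
  The errors in the two-sided estimate of \<open>ln (exp_trunc r (r * s))\<close> are \<open>O(1 + ln r)\<close>
  in each coordinate, hence vanish after division by \<open>r\<close>.
\<close>
lemma prec_F_sum_log_env_le: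
  fixes x y :: "real ^ 'n"
  assumes x: "\<forall>i. 0 \<le> x $ i" and y: "\<forall>i. 0 \<le> y $ i"
    and xy: "x \<prec>\<^sub>F y" and c: "0 \<le> c"
  shows "(\<Sum>i\<in>UNIV. log_env (c * x $ i)) \<le> (\<Sum>i\<in>UNIV. log_env (c * y $ i))"
proof -
  let ?X = "\<Sum>i\<in>UNIV. log_env (c * x $ i)" and ?Y = "\<Sum>i\<in>UNIV. log_env (c * y $ i)"
  have bound: "?X - real CARD('n) * ((2 + ln (real r)) / real r) \<le> ?Y" if r: "1 \<le> r" for r
  proof -
    let ?p = "\<lambda>z i. exp_trunc r (real r * (c * (z :: real ^ 'n) $ i))"
    have pos: "0 < ?p x i" "0 < ?p y i" for i
      using x y c by (auto intro!: exp_trunc_pos)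
    have "real r * ?X - real CARD('n) * (2 + ln (real r))
        = (\<Sum>i\<in>UNIV. real r * log_env (c * x $ i) - 2 - ln (real r))"
      by (simp add: sum_subtractf sum_distrib_left algebra_simps)
    also have "\<dots> \<le> (\<Sum>i\<in>UNIV. ln (?p x i))"
      by (intro sum_mono ln_exp_trunc_lower r) (use x c in simp)
    also have "\<dots> = ln (\<Prod>i\<in>UNIV. ?p x i)"
      by (rule ln_prod[symmetric]) (use pos(1) in \<open>auto simp: less_le\<close>)
    also have "\<dots> \<le> ln (\<Prod>i\<in>UNIV. ?p y i)"
    proof (rule ln_mono)
      show "(\<Prod>i\<in>UNIV. ?p x i) \<le> (\<Prod>i\<in>UNIV. ?p y i)"
        using prec_F_prod_exp_trunc_le[OF xy, of "real r * c" r] c r by (simp add: mult.assoc)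
    qed (auto intro!: prod_pos pos)
    also have "\<dots> = (\<Sum>i\<in>UNIV. ln (?p y i))"
      by (rule ln_prod) (use pos(2) in \<open>auto simp: less_le\<close>)
    also have "\<dots> \<le> (\<Sum>i\<in>UNIV. real r * log_env (c * y $ i))"
    proof (rule sum_mono)
      fix i
      have "?p y i \<le> exp (real r * log_env (c * y $ i))"
        by (rule exp_trunc_upper) (use y c in simp)
      then have "ln (?p y i) \<le> ln (exp (real r * log_env (c * y $ i)))"
        using pos(2)[of i] by (intro ln_mono) auto
      then show "ln (?p y i) \<le> real r * log_env (c * y $ i)" by simp
    qed
    also have "\<dots> = real r * ?Y"
      by (simp add: sum_distrib_left)
    finally show ?thesis
      using r by (simp add: field_simps)
  qed
  have "(\<lambda>r. (2 + ln (real r)) / real r) \<longlonglongrightarrow> 0"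
  proof -
    have "(\<lambda>r. 2 / real r + ln (real r) / real r) \<longlonglongrightarrow> 0 + 0"
      by (intro tendsto_add lim_const_over_n lim_ln_over_n)
    then show ?thesis by (simp add: add_divide_distrib)
  qed
  then have "(\<lambda>r. ?X - real CARD('n) * ((2 + ln (real r)) / real r)) \<longlonglongrightarrow> ?X - real CARD('n) * 0"
    by (intro tendsto_intros)
  then show ?thesis
    using bound by (intro LIMSEQ_le_const2[of _ ?X]) auto
qed

section \<open>The extremal test functions\<close>

text \<open>
  The function \<open>\<psi>\<close> belonging to \<open>\<phi> t = min t a\<close>.  At \<open>a = 0\<close> division by zero makes it vanish,
  so that the grid point \<open>0\<close> below needs no separate treatment.
\<close>
definition min_potential :: "real \<Rightarrow> real \<Rightarrow> real" where
  "min_potential a s = a * log_env (s / a)"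

lemma has_integral_min_potential:
  assumes "0 \<le> a" "0 \<le> s"
  shows "((\<lambda>t. min t a / t) has_integral min_potential a s) {0<..s}"
proof (cases "a = 0")
  case True
  have "((\<lambda>t. 0) has_integral 0) {0<..s}" by simp
  then have "((\<lambda>t. min t 0 / t) has_integral 0) {0<..s}"
    by (rule has_integral_eq[rotated]) auto
  then show ?thesis using True by (simp add: min_potential_def)
next
  case False
  with assms have a: "0 < a" by simp
  let ?G = "min_potential a"
  have G_le: "?G t = t" if "t \<le> a" for t
    using that a by (simp add: min_potential_def log_env_def)
  have G_ge: "?G t = a + a * ln (t / a)" if "a \<le> t" for t
    using that a by (auto simp: min_potential_def log_env_def distrib_left)
  have cont: "continuous_on {0..s} ?G"
  proof -
    have "continuous_on ({0..a} \<union> {a..max a s}) ?G"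
    proof (rule continuous_on_closed_Un)
      show "continuous_on {0..a} ?G"
        by (rule continuous_on_eq[OF continuous_on_id]) (auto simp: G_le)
      have "continuous_on {a..max a s} (\<lambda>t. a + a * ln (t / a))"
        using a by (intro continuous_intros) auto
      then show "continuous_on {a..max a s} ?G"
        by (rule continuous_on_eq) (auto simp: G_ge)
    qed auto
    then show ?thesis
      by (rule continuous_on_subset) auto
  qed
  have deriv: "(?G has_vector_derivative min t a / t) (at t)" if t: "t \<in> {0<..<s} - {a}" for t
  proof (cases "t < a")
    case True
    have "((\<lambda>t. t) has_vector_derivative min t a / t) (at t)"
      using True t by (auto intro!: derivative_eq_intros)
    then show ?thesis
      by (rule has_vector_derivative_transform_within_open[of _ _ _ "{..<a}"])
        (use True G_le in auto)
  next
    case False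
    have "((\<lambda>t. a + a * ln (t / a)) has_real_derivative min t a / t) (at t)"
      using False t a by (auto intro!: derivative_eq_intros simp: field_simps)
    then have "((\<lambda>t. a + a * ln (t / a)) has_vector_derivative min t a / t) (at t)"
      by (simp add: has_real_derivative_iff_has_vector_derivative)
    then show ?thesis
      by (rule has_vector_derivative_transform_within_open[of _ _ _ "{a<..}"])
        (use False t G_ge in auto)
  qed
  have "((\<lambda>t. min t a / t) has_integral ?G s - ?G 0) {0..s}"
    by (rule fundamental_theorem_of_calculus_interior_strong[of "{a}"])
      (use assms deriv cont in auto)
  then have "((\<lambda>t. min t a / t) has_integral ?G s) {0..s}"
    using a by (simp add: G_le)
  then show ?thesis
    by (rule has_integral_spike_set_eq[THEN iffD1, rotated 2])
      (auto intro!: negligible_subset[OF negligible_sing[of 0]])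
qed

section \<open>Approximation of concave functions\<close>

definition grid_slope :: "(real \<Rightarrow> real) \<Rightarrow> real \<Rightarrow> nat \<Rightarrow> real" where
  "grid_slope \<phi> h j = (\<phi> (real (Suc j) * h) - \<phi> (real j * h)) / h"

lemma grid_slope_nonneg:
  assumes "mono_on {0..} \<phi>" "0 < h"
  shows "0 \<le> grid_slope \<phi> h j"
proof -
  have "\<phi> (real j * h) \<le> \<phi> (real (Suc j) * h)"
    by (rule mono_onD[OF assms(1)]) (use assms(2) in \<open>auto intro: mult_right_mono\<close>)
  then show ?thesis using assms(2) by (simp add: grid_slope_def)
qed

lemma grid_slope_antimono:
  assumes "concave_on {0..} \<phi>" "0 < h"
  shows "grid_slope \<phi> h (Suc j) \<le> grid_slope \<phi> h j"
proof -
  have "(1 - 1/2) * \<phi> (real j * h) + 1/2 * \<phi> (real (Suc (Suc j)) * h)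
      \<le> \<phi> ((1 - 1/2) *\<^sub>R (real j * h) + (1/2) *\<^sub>R (real (Suc (Suc j)) * h))"
    by (rule concave_onD[OF assms(1)]) (use assms(2) in auto)
  also have "(1 - 1/2) *\<^sub>R (real j * h) + (1/2) *\<^sub>R (real (Suc (Suc j)) * h) = real (Suc j) * h"
    by (simp add: field_simps)
  finally show ?thesis
    unfolding grid_slope_def using assms(2) by (intro divide_right_mono) auto
qed

text \<open>
  For \<open>\<phi> 0 = 0\<close>, the function on \<open>[0, m * h]\<close> that agrees with \<open>\<phi>\<close> at the multiples of
  \<open>h\<close> and is affine between them: the factor \<open>min t ((j + 1) * h) - min t (j * h)\<close> is
  the length of the part of the \<open>j\<close>-th cell to the left of \<open>t\<close>.
\<close>
definition interpolant :: "(real \<Rightarrow> real) \<Rightarrow> real \<Rightarrow> nat \<Rightarrow> real \<Rightarrow> real" where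
  "interpolant \<phi> h m t = (\<Sum>j<m. grid_slope \<phi> h j
     * (min t (real (Suc j) * h) - min t (real j * h)))"

text \<open>
  The chord lies below a concave function.  Conversely, the interpolant at \<open>t\<close> is at least the
  value at the grid point \<open>k * h\<close> preceding \<open>t\<close>, and the chord from the origin to
  \<open>(t, \<phi> t)\<close> bounds that value below by \<open>(k * h / t) * \<phi> t\<close>.  Together the two
  bounds give pointwise convergence as \<open>h\<close> tends to zero.
\<close>
lemma interpolant_bounds:
  fixes \<phi> :: "real \<Rightarrow> real"
  assumes \<phi>0: "\<phi> 0 = 0" and mono: "mono_on {0..} \<phi>" and conc: "concave_on {0..} \<phi>"
    and h: "0 < h" and t: "0 < t" "t \<le> real m * h"
  shows "interpolant \<phi> h m t \<le> \<phi> t" "(1 - h / t) * \<phi> t \<le> interpolant \<phi> h m t"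
proof -
  have conc': "(1 - u) * \<phi> p + u * \<phi> q \<le> \<phi> ((1 - u) * p + u * q)"
    if "0 \<le> u" "u \<le> 1" "0 \<le> p" "0 \<le> q" for u p q
    using concave_onD[OF conc, of u p q] that by simp
  have nonneg: "0 \<le> \<phi> s" if "0 \<le> s" for s
    using mono_onD[OF mono, of 0 s] that \<phi>0 by simp
  \<comment> \<open>The cell with \<open>k * h < t \<le> (k + 1) * h\<close>; rounding up keeps \<open>k < m\<close> at \<open>t = m * h\<close>.\<close>
  define k where "k = nat \<lceil>t / h\<rceil> - 1"
  have "0 < t / h" "t / h \<le> real m"
    using h t by (auto simp: field_simps)
  then have "real k < t / h" "t / h \<le> real (Suc k)" and km: "k < m"
    unfolding k_def by linarith+
  then have k: "real k * h < t" "t \<le> real (Suc k) * h"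
    using h by (auto simp: field_simps)
  define u where "u = (t - real k * h) / h"
  have u: "0 \<le> u" "u \<le> 1"
    using k h by (auto simp: u_def field_simps)
  have t_eq: "t = (1 - u) * (real k * h) + u * (real (Suc k) * h)"
    using h by (simp add: u_def field_simps)
  let ?d = "\<lambda>j. \<phi> (real (Suc j) * h) - \<phi> (real j * h)"
  let ?s = "\<lambda>j. grid_slope \<phi> h j * (min t (real (Suc j) * h) - min t (real j * h))"
  have below: "?s j = ?d j" if "j < k" for j
  proof -
    have "real (Suc j) * h \<le> real k * h"
      using that h by (intro mult_right_mono) auto
    then have "min t (real (Suc j) * h) = real (Suc j) * h" "min t (real j * h) = real j * h"
      using k h by (auto simp: distrib_right)
    then show ?thesis using h by (simp add: grid_slope_def distrib_right)
  qed
  have above: "?s j = 0" if "k < j" for j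
  proof -
    have "real (Suc k) * h \<le> real j * h"
      using that h by (intro mult_right_mono) auto
    then have "min t (real (Suc j) * h) = t" "min t (real j * h) = t"
      using k h by (auto simp: distrib_right)
    then show ?thesis by simp
  qed
  have "interpolant \<phi> h m t = sum ?s {..<Suc k}"
    unfolding interpolant_def using km above by (intro sum.mono_neutral_right) auto
  also have "\<dots> = (\<Sum>j<k. ?d j) + ?s k"
    using below by simp
  also have "(\<Sum>j<k. ?d j) = \<phi> (real k * h)"
    using sum_lessThan_telescope[of "\<lambda>j. \<phi> (real j * h)" k] \<phi>0 by simp
  also have "?s k = u * ?d k"
    using k by (simp add: grid_slope_def u_def min_def)
  finally have eq: "interpolant \<phi> h m t
      = (1 - u) * \<phi> (real k * h) + u * \<phi> (real (Suc k) * h)"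
    by (simp add: algebra_simps)
  show "interpolant \<phi> h m t \<le> \<phi> t"
    unfolding eq by (subst t_eq, rule conc') (use u h in auto)
  have "(1 - h / t) * \<phi> t \<le> real k * h / t * \<phi> t"
  proof (rule mult_right_mono)
    have "1 - h / t = (t - h) / t"
      using t by (simp add: diff_divide_distrib)
    also have "\<dots> \<le> real k * h / t"
      using k t by (intro divide_right_mono) (auto simp: distrib_right)
    finally show "1 - h / t \<le> real k * h / t" .
  qed (use t nonneg in auto)
  also have "\<dots> \<le> \<phi> (real k * h)"
    using conc'[of "real k * h / t" 0 t] k t h \<phi>0 by (simp add: field_simps)
  also have "\<dots> \<le> interpolant \<phi> h m t"
  proof -
    have "\<phi> (real k * h) \<le> \<phi> (real (Suc k) * h)"
      by (rule mono_onD[OF mono]) (use h in \<open>auto intro: mult_right_mono\<close>)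
    then have "0 \<le> u * (\<phi> (real (Suc k) * h) - \<phi> (real k * h))"
      using u by simp
    then show ?thesis unfolding eq by (simp add: algebra_simps)
  qed
  finally show "(1 - h / t) * \<phi> t \<le> interpolant \<phi> h m t" .
qed

text \<open>
  Summation by parts in the form of an inequality: the boundary term on the left
  strengthens the nonnegativity of the sum enough for induction on \<open>m\<close>.
\<close>
lemma sum_antimono_times_increments_ge:
  fixes d U :: "nat \<Rightarrow> real"
  assumes "\<And>j. d (Suc j) \<le> d j" "\<And>j. 0 \<le> U j" "U 0 = 0"
  shows "d m * U m \<le> (\<Sum>j<m. d j * (U (Suc j) - U j))"
proof (induction m)
  case 0
  then show ?case using assms by simp
next
  case (Suc m)
  have "d (Suc m) * U (Suc m) \<le> d m * U (Suc m)"
    by (rule mult_right_mono) (use assms in auto)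
  then show ?case using Suc by (simp add: algebra_simps)
qed

definition interpolant_potential :: "(real \<Rightarrow> real) \<Rightarrow> real \<Rightarrow> nat \<Rightarrow> real \<Rightarrow> real" where
  "interpolant_potential \<phi> h m s = (\<Sum>j<m. grid_slope \<phi> h j
     * (min_potential (real (Suc j) * h) s - min_potential (real j * h) s))"

lemma has_integral_interpolant:
  assumes "0 \<le> h" "0 \<le> s"
  shows "((\<lambda>t. interpolant \<phi> h m t / t) has_integral interpolant_potential \<phi> h m s) {0<..s}"
proof -
  have "((\<lambda>t. \<Sum>j<m. grid_slope \<phi> h j
           * (min t (real (Suc j) * h) / t - min t (real j * h) / t))
         has_integral interpolant_potential \<phi> h m s) {0<..s}"
    unfolding interpolant_potential_def
    by (intro has_integral_sum has_integral_mult_right has_integral_diff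
        has_integral_min_potential) (use assms in auto)
  then show ?thesis
    by (simp add: interpolant_def sum_divide_distrib flip: diff_divide_distrib)
qed

text \<open>
  The interpolants lie between \<open>0\<close> and \<open>\<phi>\<close>, so \<open>\<phi> t / t\<close> itself is a dominating
  function.  Keeping the right end \<open>M\<close> of the grid fixed lets one sequence serve all
  \<open>s \<le> M\<close>, in particular all coordinates of two given vectors.
\<close>
lemma interpolant_potential_tendsto:
  fixes \<phi> :: "real \<Rightarrow> real"
  assumes \<phi>0: "\<phi> 0 = 0" and mono: "mono_on {0..} \<phi>" and conc: "concave_on {0..} \<phi>"
    and int: "((\<lambda>t. \<phi> t / t) has_integral I) {0<..s}" and s: "0 \<le> s" "s \<le> M" and M: "0 < M"
  shows "(\<lambda>N. interpolant_potential \<phi> (M / real (Suc N)) (Suc N) s) \<longlonglongrightarrow> I"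
proof -
  let ?h = "\<lambda>N. M / real (Suc N)"
  let ?f = "\<lambda>N t. interpolant \<phi> (?h N) (Suc N) t / t"
  have nonneg: "0 \<le> \<phi> t" if "0 \<le> t" for t
    using mono_onD[OF mono, of 0 t] that \<phi>0 by simp
  have h: "0 < ?h N" "real (Suc N) * ?h N = M" for N
    using M by auto
  have upper: "interpolant \<phi> (?h N) (Suc N) t \<le> \<phi> t"
    and lower: "(1 - ?h N / t) * \<phi> t \<le> interpolant \<phi> (?h N) (Suc N) t"
    if "t \<in> {0<..s}" for t N
    using interpolant_bounds[OF \<phi>0 mono conc h(1)[of N], of t "Suc N"] that s
    unfolding h(2) by auto
  have interp_nonneg: "0 \<le> interpolant \<phi> (?h N) (Suc N) t" for t N
  proof -
    have "min t (real j * ?h N) \<le> min t (real (Suc j) * ?h N)" for j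
      by (rule min.mono[OF order_refl mult_right_mono]) (use h(1)[of N] in auto)
    then show ?thesis
      unfolding interpolant_def using grid_slope_nonneg[OF mono h(1)[of N]]
      by (intro sum_nonneg mult_nonneg_nonneg) auto
  qed
  have "(\<lambda>N. integral {0<..s} (?f N)) \<longlonglongrightarrow> integral {0<..s} (\<lambda>t. \<phi> t / t)"
  proof (rule dominated_convergence(2))
    show "?f N integrable_on {0<..s}" for N
      by (rule has_integral_integrable[OF has_integral_interpolant[OF less_imp_le[OF h(1)] s(1)]])
    show "(\<lambda>t. \<phi> t / t) integrable_on {0<..s}"
      using int by blast
    show "norm (?f N t) \<le> \<phi> t / t" if "t \<in> {0<..s}" for N t
      using interp_nonneg[of N t] upper[OF that, of N] that by (simp add: divide_right_mono)
    show "(\<lambda>N. ?f N t) \<longlonglongrightarrow> \<phi> t / t" if t: "t \<in> {0<..s}" for t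
    proof (rule tendsto_divide)
      have "(\<lambda>N. 1 / real (Suc N)) \<longlonglongrightarrow> 0"
        using LIMSEQ_Suc[OF lim_const_over_n[of 1]] by simp
      then have "(\<lambda>N. (1 - M * (1 / real (Suc N)) / t) * \<phi> t) \<longlonglongrightarrow> (1 - M * 0 / t) * \<phi> t"
        by (intro tendsto_intros) (use t in auto)
      then have low: "(\<lambda>N. (1 - ?h N / t) * \<phi> t) \<longlonglongrightarrow> \<phi> t"
        by simp
      show "(\<lambda>N. interpolant \<phi> (?h N) (Suc N) t) \<longlonglongrightarrow> \<phi> t"
        by (rule tendsto_sandwich[OF _ _ low tendsto_const];
            intro always_eventually allI upper lower t)
    qed (use t in auto)
  qed
  moreover have "integral {0<..s} (?f N) = interpolant_potential \<phi> (?h N) (Suc N) s" for N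
    by (rule integral_unique[OF has_integral_interpolant[OF less_imp_le[OF h(1)] s(1)]])
  ultimately show ?thesis
    using int by (simp add: integral_unique)
qed

section \<open>The comparison\<close>

text \<open>
  The summation by parts is applied to the gap \<open>U j\<close> between the sums of
  \<open>min_potential (j * h)\<close> over the two vectors; by scaling, \<open>U j \<ge> 0\<close> is the inequality for
  \<open>log_env\<close>.
\<close>
lemma prec_F_interpolant_potential_le:
  fixes x y :: "real ^ 'n" and \<phi> :: "real \<Rightarrow> real"
  assumes x: "\<forall>i. 0 \<le> x $ i" and y: "\<forall>i. 0 \<le> y $ i" and xy: "x \<prec>\<^sub>F y"
    and mono: "mono_on {0..} \<phi>" and conc: "concave_on {0..} \<phi>" and h: "0 < h"
  shows "(\<Sum>i\<in>UNIV. interpolant_potential \<phi> h m (x $ i))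
       \<le> (\<Sum>i\<in>UNIV. interpolant_potential \<phi> h m (y $ i))"
proof -
  define S where "S z j = (\<Sum>i\<in>UNIV. min_potential (real j * h) (z $ i))" for z :: "real ^ 'n" and j
  define U where "U j = S y j - S x j" for j
  have sum_eq: "(\<Sum>i\<in>UNIV. interpolant_potential \<phi> h m (z $ i)) = (\<Sum>j<m. grid_slope \<phi> h j * (S z (Suc j) - S z j))"
    for z :: "real ^ 'n"
    unfolding interpolant_potential_def S_def
    by (subst sum.swap) (simp only: sum_distrib_left[symmetric] sum_subtractf)
  have U_nonneg: "0 \<le> U j" for j
  proof -
    have "(\<Sum>i\<in>UNIV. log_env (1 / (real j * h) * x $ i)) \<le> (\<Sum>i\<in>UNIV. log_env (1 / (real j * h) * y $ i))"
      by (rule prec_F_sum_log_env_le[OF x y xy]) (use h in auto)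
    then have "real j * h * (\<Sum>i\<in>UNIV. log_env (x $ i / (real j * h)))
        \<le> real j * h * (\<Sum>i\<in>UNIV. log_env (y $ i / (real j * h)))"
      using h by (intro mult_left_mono) auto
    then show ?thesis
      by (simp add: U_def S_def min_potential_def sum_distrib_left)
  qed
  have "0 \<le> grid_slope \<phi> h m * U m"
    using grid_slope_nonneg[OF mono h] U_nonneg by simp
  also have "\<dots> \<le> (\<Sum>j<m. grid_slope \<phi> h j * (U (Suc j) - U j))"
    by (rule sum_antimono_times_increments_ge[where d = "grid_slope \<phi> h",
          OF grid_slope_antimono[OF conc h] U_nonneg])
      (simp add: U_def S_def min_potential_def)
  also have "\<dots> = (\<Sum>j<m. grid_slope \<phi> h j * (S y (Suc j) - S y j)) - (\<Sum>j<m. grid_slope \<phi> h j * (S x (Suc j) - S x j))"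
    by (simp add: U_def sum_subtractf[symmetric] algebra_simps)
  finally show ?thesis by (simp add: sum_eq)
qed

text \<open>
  Lowering the value at the origin keeps concavity, since the origin is an extreme point of
  the half line.  Since it changes no integral over \<open>{0<..s}\<close>, one may assume \<open>\<phi> 0 = 0\<close>.
\<close>
lemma concave_on_drop_at_zero:
  fixes \<phi> :: "real \<Rightarrow> real"
  assumes conc: "concave_on {0..} \<phi>" and nonneg: "0 \<le> \<phi> 0"
  shows "concave_on {0..} (\<phi>(0 := 0))"
  unfolding concave_on_iff
proof (intro conjI ballI allI impI)
  fix p q u v :: real
  assume *: "p \<in> {0..}" "q \<in> {0..}" "0 \<le> u" "0 \<le> v" "u + v = 1"
  have "u * (\<phi>(0 := 0)) p + v * (\<phi>(0 := 0)) q \<le> u * \<phi> p + v * \<phi> q"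
    using * nonneg by (intro add_mono mult_left_mono) auto
  also have "\<dots> \<le> \<phi> (u *\<^sub>R p + v *\<^sub>R q)"
    using conc * by (auto simp: concave_on_iff)
  finally have main: "u * (\<phi>(0 := 0)) p + v * (\<phi>(0 := 0)) q \<le> \<phi> (u *\<^sub>R p + v *\<^sub>R q)" .
  show "u * (\<phi>(0 := 0)) p + v * (\<phi>(0 := 0)) q \<le> (\<phi>(0 := 0)) (u *\<^sub>R p + v *\<^sub>R q)"
  proof (cases "u *\<^sub>R p + v *\<^sub>R q = 0")
    case True
    then have "u * p = 0 \<and> v * q = 0"
      using * by (simp add: add_nonneg_eq_0_iff)
    then have "u * (\<phi>(0 := 0)) p + v * (\<phi>(0 := 0)) q = 0"
      by auto
    then show ?thesis using True by (simp only: fun_upd_same order_refl)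
  next
    case False
    then show ?thesis using main by simp
  qed
qed simp

theorem theorem9:
  fixes x y :: "real ^ 'n"
  assumes "\<forall>i. 0 \<le> x $ i" and "\<forall>i. 0 \<le> y $ i"
    and "x \<prec>\<^sub>F y"
  shows "x \<prec>\<^sub>L y"
  unfolding prec_L_def
proof
  fix \<psi> assume "\<psi> \<in> L_functions"
  then obtain \<phi>0 where \<phi>0: "\<phi>0 \<in> {0..} \<rightarrow> {0..}" "mono_on {0..} \<phi>0" "concave_on {0..} \<phi>0"
    and int0: "\<And>s. 0 \<le> s \<Longrightarrow> ((\<lambda>t. \<phi>0 t / t) has_integral \<psi> s) {0<..s}"
    unfolding L_functions_def by blast
  define \<phi> where "\<phi> = \<phi>0(0 := 0)"
  have zero: "\<phi> 0 = 0" by (simp add: \<phi>_def)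
  have mono: "mono_on {0..} \<phi>"
    using \<phi>0 by (auto simp: \<phi>_def mono_on_def Pi_iff)
  have conc: "concave_on {0..} \<phi>"
    unfolding \<phi>_def using \<phi>0 by (intro concave_on_drop_at_zero) auto
  have int: "((\<lambda>t. \<phi> t / t) has_integral \<psi> s) {0<..s}" if "0 \<le> s" for s
    by (rule has_integral_eq[OF _ int0[OF that]]) (simp add: \<phi>_def)
  define M where "M = 1 + (\<Sum>i\<in>UNIV. x $ i) + (\<Sum>i\<in>UNIV. y $ i)"
  have sums: "0 \<le> (\<Sum>i\<in>UNIV. x $ i)" "0 \<le> (\<Sum>i\<in>UNIV. y $ i)"
    using assms by (auto intro: sum_nonneg)
  have M: "0 < M" "x $ i \<le> M" "y $ i \<le> M" for i
    using member_le_sum[of i UNIV "($) x"] member_le_sum[of i UNIV "($) y"] assms sums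
    by (auto simp: M_def)
  have lim: "(\<lambda>N. \<Sum>i\<in>UNIV. interpolant_potential \<phi> (M / real (Suc N)) (Suc N) (z $ i))
      \<longlonglongrightarrow> (\<Sum>i\<in>UNIV. \<psi> (z $ i))"
    if "\<And>i. 0 \<le> z $ i" "\<And>i. z $ i \<le> M" for z :: "real ^ 'n"
    by (intro tendsto_sum interpolant_potential_tendsto[OF zero mono conc int] that M)
  show "(\<Sum>i\<in>UNIV. \<psi> (x $ i)) \<le> (\<Sum>i\<in>UNIV. \<psi> (y $ i))"
  proof (rule LIMSEQ_le[OF lim lim])
    show "\<exists>N0. \<forall>N\<ge>N0.
        (\<Sum>i\<in>UNIV. interpolant_potential \<phi> (M / real (Suc N)) (Suc N) (x $ i))
      \<le> (\<Sum>i\<in>UNIV. interpolant_potential \<phi> (M / real (Suc N)) (Suc N) (y $ i))"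
      using M(1) by (auto intro!: prec_F_interpolant_potential_le[OF assms mono conc])
  qed (use assms M in auto)
qed

end
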